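(* Any non-trivial $\bar S_2$-module $M\in\Omega^{\bar S_2}_{\mathbf 1}$ is a free $U(\mathfrak h)$-module of finite rank.
   Context: $\bar S_2$ is the complex Lie algebra of polynomial vector fields $p_1\partial_1+p_2\partial_2$, $p_i\in\mathbb C[t_1,t_2]$, $\partial_i=\partial/\partial t_i$, with constant divergence $\partial_1(p_1)+\partial_2(p_2)\in\mathbb C$. $d_i=t_i\partial_i$ and $\mathfrak h=\mathbb Cd_1\oplus\mathbb Cd_2$. Let $\Delta_2=\mathrm{span}\{\partial_1,\partial_2\}$ and let $\phi_{\mathbf 1}:\Delta_2\to\mathbb C$ be the linear map with $\phi_{\mathbf 1}(\partial_1)=\phi_{\mathbf 1}(\partial_2)=1$. $\Omega^{\bar S_2}_{\mathbf 1}$ is the category of $\bar S_2$-modules $M$ on which $\Delta_2$ acts locally finitely, such that for every $v\in M$ and $x\in\Delta_2$ one has $(x-\phi_{\mathbf 1}(x))^kv=0$ for some $k\in\mathbb N$, and such that $\mathrm{Wh}_{\mathbf 1}(M)=\{v\in M:\partial_1v=\partial_2v=v\}$ is finite-dimensional. *)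

theory Defs
  imports
    "HOL-Computational_Algebra.Polynomial"
    "HOL-Library.Poly_Mapping"
    "HOL-Library.Product_Plus"
    "HOL-Library.FuncSet"
    "HOL-Algebra.QuotRing"
    Complex_Main
begin

section \<open>The Lie algebra of constant-divergence polynomial vector fields\<close>

text \<open>A polynomial in two variables is an element of \<open>(\<complex>[t\<^sub>1])[t\<^sub>2]\<close>; the outer variable
  is \<open>t\<^sub>2\<close>. The vector field \<open>p\<^sub>1\<partial>\<^sub>1 + p\<^sub>2\<partial>\<^sub>2\<close> is the pair \<open>(p\<^sub>1, p\<^sub>2)\<close>.\<close>

type_synonym poly2 = "complex poly poly"
type_synonym vfield = "poly2 \<times> poly2"

definition const2 :: "complex \<Rightarrow> poly2" where
  "const2 c = [:[:c:]:]"

definition var1 :: poly2 where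
  "var1 = [:[:0, 1:]:]"

definition var2 :: poly2 where
  "var2 = [:0, 1:]"

definition pd1 :: "poly2 \<Rightarrow> poly2" where
  "pd1 p = map_poly pderiv p"

definition pd2 :: "poly2 \<Rightarrow> poly2" where
  "pd2 p = pderiv p"

definition vf_apply :: "vfield \<Rightarrow> poly2 \<Rightarrow> poly2" where
  "vf_apply X f = fst X * pd1 f + snd X * pd2 f"

text \<open>The commutator \<open>XY - YX\<close> of derivations, in coordinates (see \<open>vf_apply_bracket\<close> below).\<close>

definition vf_bracket :: "vfield \<Rightarrow> vfield \<Rightarrow> vfield" where
  "vf_bracket X Y =
     (vf_apply X (fst Y) - vf_apply Y (fst X), vf_apply X (snd Y) - vf_apply Y (snd X))"

definition vf_scale :: "complex \<Rightarrow> vfield \<Rightarrow> vfield" where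
  "vf_scale c X = (const2 c * fst X, const2 c * snd X)"

definition divergence :: "vfield \<Rightarrow> poly2" where
  "divergence X = pd1 (fst X) + pd2 (snd X)"

definition Sbar2 :: "vfield set" where
  "Sbar2 = {X. \<exists>c. divergence X = const2 c}"

definition del1 :: vfield where "del1 = (1, 0)"
definition del2 :: vfield where "del2 = (0, 1)"
definition d1 :: vfield where "d1 = (var1, 0)"
definition d2 :: vfield where "d2 = (0, var2)"

lemma const2_simps:
  "const2 0 = 0" "const2 1 = 1"
  "const2 (a + b) = const2 a + const2 b"
  "const2 (a - b) = const2 a - const2 b"
  "const2 (a * b) = const2 a * const2 b"
  by (simp_all add: const2_def one_pCons)

interpretation vf: vector_space vf_scale
  by unfold_locales (auto simp: vf_scale_def const2_simps algebra_simps)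

definition Delta2 :: "vfield set" where
  "Delta2 = vf.span {del1, del2}"

definition cartan :: "vfield set" where
  "cartan = vf.span {d1, d2}"

text \<open>On \<open>\<Delta>\<^sub>2\<close> both components are constants, and \<open>\<phi>\<^sub>\<one>(a\<partial>\<^sub>1 + b\<partial>\<^sub>2) = a + b\<close>
  (see \<open>phi_one_Delta2\<close>).\<close>

definition phi_one :: "vfield \<Rightarrow> complex" where
  "phi_one X = coeff (coeff (fst X) 0) 0 + coeff (coeff (snd X) 0) 0"

lemma phi_one_Delta2:
  "phi_one (vf_scale a del1 + vf_scale b del2) = a + b"
  by (simp add: phi_one_def vf_scale_def del1_def del2_def const2_def)

lemma pd1_add: "pd1 (p + q) = pd1 p + pd1 q"
  by (auto simp: pd1_def poly_eq_iff coeff_map_poly pderiv_add)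

lemma pd1_pCons: "pd1 (pCons a p) = pCons (pderiv a) (pd1 p)"
  by (auto simp: pd1_def poly_eq_iff coeff_map_poly coeff_pCons split: nat.splits)

lemma pd1_0 [simp]: "pd1 0 = 0"
  by (simp add: pd1_def)

lemma pd1_smult: "pd1 (smult a p) = smult (pderiv a) p + smult a (pd1 p)"
  by (induction p) (simp_all add: pd1_pCons pderiv_mult algebra_simps)

lemma pd1_mult: "pd1 (p * q) = pd1 p * q + p * pd1 q"
proof (induction p)
  case (pCons a p)
  have "pd1 (pCons a p * q) = pd1 (smult a q) + pd1 (pCons 0 (p * q))"
    by (simp add: pd1_add)
  then show ?case
    using pCons.IH by (simp add: pd1_smult pd1_pCons algebra_simps)
qed simp

lemma pd1_diff: "pd1 (p - q) = pd1 p - pd1 q"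
  by (metis pd1_add add_diff_cancel diff_add_cancel)

lemma pd1_pd2: "pd1 (pd2 p) = pd2 (pd1 p)"
  by (induction p) (simp_all add: pd2_def pd1_add pd1_pCons pderiv_pCons)

lemma vf_apply_bracket:
  "vf_apply (vf_bracket X Y) f = vf_apply X (vf_apply Y f) - vf_apply Y (vf_apply X f)"
  by (simp add: vf_apply_def vf_bracket_def pd1_add pd1_mult pd1_pd2[symmetric]
      pd2_def pderiv_add pderiv_mult algebra_simps pd1_pd2[unfolded pd2_def])

lemma divergence_bracket:
  "divergence (vf_bracket X Y) = vf_apply X (divergence Y) - vf_apply Y (divergence X)"
  by (simp add: vf_apply_def vf_bracket_def divergence_def pd1_add pd1_diff pd1_mult
      pd2_def pderiv_add pderiv_diff pderiv_mult algebra_simps pd1_pd2[unfolded pd2_def])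

lemma vf_apply_const2 [simp]: "vf_apply X (const2 c) = 0"
  by (simp add: vf_apply_def const2_def pd1_pCons pd2_def pderiv_pCons)

lemma Sbar2_bracket: "X \<in> Sbar2 \<Longrightarrow> Y \<in> Sbar2 \<Longrightarrow> vf_bracket X Y \<in> Sbar2"
  using const2_simps(1) by (auto simp: Sbar2_def divergence_bracket intro!: exI[of _ 0])

lemma Sbar2_subspace: "vf.subspace Sbar2"
proof (rule vf.subspaceI)
  show "0 \<in> Sbar2"
    by (auto simp: Sbar2_def divergence_def pd2_def const2_simps intro!: exI[of _ 0])
next
  fix X Y assume "X \<in> Sbar2" "Y \<in> Sbar2"
  then obtain a b where "divergence X = const2 a" "divergence Y = const2 b"
    by (auto simp: Sbar2_def)
  then have "divergence (X + Y) = const2 (a + b)"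
    by (simp add: divergence_def pd1_add pd2_def pderiv_add const2_simps algebra_simps)
  then show "X + Y \<in> Sbar2" by (auto simp: Sbar2_def)
next
  fix c X assume "X \<in> Sbar2"
  then obtain a where "divergence X = const2 a" by (auto simp: Sbar2_def)
  then have "divergence (vf_scale c X) = const2 (c * a)"
    by (simp add: divergence_def vf_scale_def pd1_mult pd2_def pderiv_mult const2_simps
        ring_distribs flip: \<open>divergence X = const2 a\<close>)
      (simp add: const2_def pd1_pCons pderiv_pCons)
  then show "vf_scale c X \<in> Sbar2" by (auto simp: Sbar2_def)
qed

lemma cartan_subset_Sbar2: "cartan \<subseteq> Sbar2"
  unfolding cartan_def
proof (rule vf.span_minimal[OF _ Sbar2_subspace])
  have "divergence d1 = const2 1" "divergence d2 = const2 1"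
    by (simp_all add: divergence_def d1_def d2_def var1_def var2_def pd1_pCons pd2_def
        pderiv_pCons const2_def one_pCons)
  then show "{d1, d2} \<subseteq> Sbar2" by (auto simp: Sbar2_def)
qed

lemma Delta2_subset_Sbar2: "Delta2 \<subseteq> Sbar2"
  unfolding Delta2_def
proof (rule vf.span_minimal[OF _ Sbar2_subspace])
  have "divergence del1 = const2 0" "divergence del2 = const2 0"
    by (simp_all add: divergence_def del1_def del2_def pd1_pCons pd2_def
        pderiv_pCons const2_def one_pCons)
  then show "{del1, del2} \<subseteq> Sbar2" by (auto simp: Sbar2_def)
qed

lemma cartan_bracket: "X \<in> cartan \<Longrightarrow> Y \<in> cartan \<Longrightarrow> vf_bracket X Y = 0"
  unfolding cartan_def vf.span_insert vf.span_empty
  by (auto simp: vf_bracket_def vf_apply_def vf_scale_def d1_def d2_def var1_def var2_def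
      const2_def pd1_pCons pd2_def pderiv_pCons zero_prod_def prod_eq_iff algebra_simps)


section \<open>Universal enveloping algebras\<close>

text \<open>Words carry their concatenation as a (noncommutative) addition, as the convolution product
  of finitely supported functions requires. With that product, \<open>'g word \<Rightarrow>\<^sub>0 complex\<close> is the
  free associative unital algebra on the underlying set of \<open>'g\<close>.\<close>

datatype 'g word = Word (letters: "'g list")

instantiation word :: (type) monoid_add
begin

definition "zero_word = Word []"
definition "plus_word u w = Word (letters u @ letters w)"

instance
  by standard (simp_all add: zero_word_def plus_word_def)

end

type_synonym 'g free_alg = "'g word \<Rightarrow>\<^sub>0 complex"

definition gen :: "'g \<Rightarrow> 'g free_alg" where
  "gen x = Poly_Mapping.single (Word [x]) 1"

definition free_alg :: "'g set \<Rightarrow> 'g free_alg ring" where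
  "free_alg L =
     \<lparr>carrier = {f. \<forall>w \<in> Poly_Mapping.keys f. set (letters w) \<subseteq> L},
      mult = (*), one = 1, zero = 0, add = (+)\<rparr>"

text \<open>The first two families of relations turn the free algebra on the set \<open>L\<close> into the tensor
  algebra of the vector space \<open>L\<close>; the third one turns the latter into \<open>U(L)\<close>.\<close>

definition env_relations ::
  "(complex \<Rightarrow> 'g \<Rightarrow> 'g) \<Rightarrow> ('g \<Rightarrow> 'g \<Rightarrow> 'g) \<Rightarrow> 'g::ab_group_add set \<Rightarrow> 'g free_alg set" where
  "env_relations sc br L =
     {gen (x + y) - gen x - gen y | x y. x \<in> L \<and> y \<in> L} \<union>
     {gen (sc c x) - Poly_Mapping.single 0 c * gen x | c x. x \<in> L} \<union>
     {gen x * gen y - gen y * gen x - gen (br x y) | x y. x \<in> L \<and> y \<in> L}"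

definition env_ideal ::
  "(complex \<Rightarrow> 'g \<Rightarrow> 'g) \<Rightarrow> ('g \<Rightarrow> 'g \<Rightarrow> 'g) \<Rightarrow> 'g::ab_group_add set \<Rightarrow> 'g free_alg set" where
  "env_ideal sc br L = Idl\<^bsub>free_alg L\<^esub> (env_relations sc br L)"

definition env_alg ::
  "(complex \<Rightarrow> 'g \<Rightarrow> 'g) \<Rightarrow> ('g \<Rightarrow> 'g \<Rightarrow> 'g) \<Rightarrow> 'g::ab_group_add set \<Rightarrow> 'g free_alg set ring" where
  "env_alg sc br L = free_alg L Quot env_ideal sc br L"

abbreviation U_cartan :: "vfield free_alg set ring" where
  "U_cartan \<equiv> env_alg vf_scale vf_bracket cartan"

definition free_act ::
  "(complex \<Rightarrow> 'm \<Rightarrow> 'm) \<Rightarrow> ('g \<Rightarrow> 'm \<Rightarrow> 'm) \<Rightarrow> 'g free_alg \<Rightarrow> 'm::ab_group_add \<Rightarrow> 'm" where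
  "free_act sc rho f v =
     (\<Sum>w \<in> Poly_Mapping.keys f. sc (Poly_Mapping.lookup f w) (foldr rho (letters w) v))"

text \<open>The action of a residue class is that of any representative; well-definedness for the
  modules at hand is \<open>env_act_coset\<close> below.\<close>

definition env_act ::
  "(complex \<Rightarrow> 'm \<Rightarrow> 'm) \<Rightarrow> ('g \<Rightarrow> 'm \<Rightarrow> 'm) \<Rightarrow> 'g free_alg set \<Rightarrow> 'm::ab_group_add \<Rightarrow> 'm" where
  "env_act sc rho u v = (THE y. \<forall>f \<in> u. y = free_act sc rho f v)"


lemma free_alg_simps [simp]:
  "mult (free_alg L) = (*)" "one (free_alg L) = 1" "zero (free_alg L) = 0"
  "add (free_alg L) = (+)"
  by (simp_all add: free_alg_def)

lemma free_alg_carrier: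
  "f \<in> carrier (free_alg L) \<longleftrightarrow> (\<forall>w \<in> Poly_Mapping.keys f. set (letters w) \<subseteq> L)"
  by (simp add: free_alg_def)

lemma letters_0 [simp]: "letters 0 = []"
  by (simp add: zero_word_def)

lemma letters_plus [simp]: "letters (u + w) = letters u @ letters w"
  by (simp add: plus_word_def)

lemma free_alg_single [simp]:
  "set (letters w) \<subseteq> L \<Longrightarrow> Poly_Mapping.single w c \<in> carrier (free_alg L)"
  by (simp add: free_alg_carrier)

lemma free_alg_add:
  "f \<in> carrier (free_alg L) \<Longrightarrow> g \<in> carrier (free_alg L) \<Longrightarrow> f + g \<in> carrier (free_alg L)"
  using keys_add[of f g] by (fastforce simp: free_alg_carrier)

lemma free_alg_uminus: "f \<in> carrier (free_alg L) \<Longrightarrow> - f \<in> carrier (free_alg L)"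
  by (simp add: free_alg_carrier)

lemma free_alg_diff:
  "f \<in> carrier (free_alg L) \<Longrightarrow> g \<in> carrier (free_alg L) \<Longrightarrow> f - g \<in> carrier (free_alg L)"
  using free_alg_add[of f L "- g"] free_alg_uminus[of g L] by simp

lemma free_alg_mult:
  "f \<in> carrier (free_alg L) \<Longrightarrow> g \<in> carrier (free_alg L) \<Longrightarrow> f * g \<in> carrier (free_alg L)"
  using keys_mult[of f g] by (fastforce simp: free_alg_carrier)

lemma free_alg_ring: "ring (free_alg L)"
proof (rule ringI)
  show "abelian_group (free_alg L)"
  proof (rule abelian_groupI)
    fix x assume "x \<in> carrier (free_alg L)"
    then show "\<exists>y \<in> carrier (free_alg L). y \<oplus>\<^bsub>free_alg L\<^esub> x = \<zero>\<^bsub>free_alg L\<^esub>"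
      by (intro bexI[of _ "- x"]) (auto simp: free_alg_uminus)
  qed (auto simp: free_alg_add algebra_simps free_alg_carrier[of 0])
  show "Group.monoid (free_alg L)"
    by (rule monoidI) (auto simp: free_alg_mult mult.assoc free_alg_carrier[of 1])
qed (auto simp: algebra_simps)

lemma env_relations_carrier:
  assumes "\<And>x y. x \<in> L \<Longrightarrow> y \<in> L \<Longrightarrow> x + y \<in> L" "\<And>c x. x \<in> L \<Longrightarrow> sc c x \<in> L"
    and "\<And>x y. x \<in> L \<Longrightarrow> y \<in> L \<Longrightarrow> br x y \<in> L"
  shows "env_relations sc br L \<subseteq> carrier (free_alg L)"
  unfolding env_relations_def gen_def
  by (auto intro!: free_alg_diff free_alg_mult free_alg_single simp: assms)


section \<open>Modules\<close>

locale Sbar2_module = vector_space scale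
  for scale :: "complex \<Rightarrow> 'm::ab_group_add \<Rightarrow> 'm" +
  fixes rho :: "vfield \<Rightarrow> 'm \<Rightarrow> 'm"
  assumes rho_add_right: "X \<in> Sbar2 \<Longrightarrow> rho X (v + w) = rho X v + rho X w"
    and rho_scale_right: "X \<in> Sbar2 \<Longrightarrow> rho X (scale c v) = scale c (rho X v)"
    and rho_add_left: "X \<in> Sbar2 \<Longrightarrow> Y \<in> Sbar2 \<Longrightarrow> rho (X + Y) v = rho X v + rho Y v"
    and rho_scale_left: "X \<in> Sbar2 \<Longrightarrow> rho (vf_scale c X) v = scale c (rho X v)"
    and rho_bracket: "X \<in> Sbar2 \<Longrightarrow> Y \<in> Sbar2 \<Longrightarrow>
          rho (vf_bracket X Y) v = rho X (rho Y v) - rho Y (rho X v)"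
begin

definition Wh_one :: "'m set" where
  "Wh_one = {v. rho del1 v = v \<and> rho del2 v = v}"

lemma free_act_superset:
  assumes "finite A" "Poly_Mapping.keys f \<subseteq> A"
  shows "free_act scale rho f v =
           (\<Sum>w \<in> A. scale (Poly_Mapping.lookup f w) (foldr rho (letters w) v))"
  unfolding free_act_def
  by (rule sum.mono_neutral_left) (use assms in \<open>auto simp: in_keys_iff\<close>)

lemma free_act_single:
  "free_act scale rho (Poly_Mapping.single w c) v = scale c (foldr rho (letters w) v)"
  by (subst free_act_superset[of "{w}"]) auto

lemma free_act_0 [simp]: "free_act scale rho 0 v = 0"
  by (simp add: free_act_def)

lemma free_act_add:
  "free_act scale rho (f + g) v = free_act scale rho f v + free_act scale rho g v"
proof -
  let ?A = "Poly_Mapping.keys f \<union> Poly_Mapping.keys g"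
  have "Poly_Mapping.keys (f + g) \<subseteq> ?A" by (rule keys_add)
  then show ?thesis
    by (simp add: free_act_superset[of ?A] lookup_add scale_left_distrib sum.distrib)
qed

lemma free_act_diff:
  "free_act scale rho (f - g) v = free_act scale rho f v - free_act scale rho g v"
  by (metis free_act_add add_diff_cancel diff_add_cancel)

lemma free_act_sum:
  "free_act scale rho (sum f A) v = (\<Sum>a \<in> A. free_act scale rho (f a) v)"
  by (induction A rule: infinite_finite_induct) (auto simp: free_act_add)

lemma rho_sum: "X \<in> Sbar2 \<Longrightarrow> rho X (sum f A) = (\<Sum>a \<in> A. rho X (f a))"
proof (induction A rule: infinite_finite_induct)
  case (infinite A)
  then show ?case using rho_scale_right[of X 0 0] by simp
next
  case empty
  then show ?case using rho_scale_right[of X 0 0] by simp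
qed (simp add: rho_add_right)

lemma foldr_rho_sum:
  "set xs \<subseteq> Sbar2 \<Longrightarrow>
     foldr rho xs (\<Sum>a \<in> A. scale (c a) (f a)) = (\<Sum>a \<in> A. scale (c a) (foldr rho xs (f a)))"
  by (induction xs) (simp_all add: rho_sum rho_scale_right)

lemma free_act_mult:
  assumes "f \<in> carrier (free_alg Sbar2)"
  shows "free_act scale rho (f * g) v = free_act scale rho f (free_act scale rho g v)"
proof -
  have decomp:
    "h = (\<Sum>w \<in> Poly_Mapping.keys h. Poly_Mapping.single w (Poly_Mapping.lookup h w))"
    for h :: "vfield free_alg"
    by (rule poly_mapping_eqI)
      (auto simp: lookup_sum lookup_single when_def in_keys_iff sum.delta)
  have "free_act scale rho (f * g) v =
    (\<Sum>w \<in> Poly_Mapping.keys f. \<Sum>w' \<in> Poly_Mapping.keys g.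
       scale (Poly_Mapping.lookup f w * Poly_Mapping.lookup g w')
         (foldr rho (letters w) (foldr rho (letters w') v)))"
    by (subst decomp[of f], subst decomp[of g])
      (simp add: sum_product mult_single free_act_sum free_act_single)
  also have "\<dots> = (\<Sum>w \<in> Poly_Mapping.keys f. scale (Poly_Mapping.lookup f w)
       (foldr rho (letters w) (free_act scale rho g v)))"
    using assms by (intro sum.cong refl)
      (simp add: free_act_def[of _ _ g] foldr_rho_sum free_alg_carrier scale_sum_right)
  finally show ?thesis by (simp add: free_act_def[of _ _ f])
qed

lemma free_act_zero_right:
  assumes "f \<in> carrier (free_alg Sbar2)"
  shows "free_act scale rho f 0 = 0"
proof -
  have "free_act scale rho f 0 = free_act scale rho (f * 0) 0"
    using free_act_mult[OF assms, of 0 0] by simp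
  then show ?thesis by simp
qed

lemma env_relations_act:
  assumes "L \<subseteq> Sbar2" "r \<in> env_relations vf_scale vf_bracket L"
  shows "free_act scale rho r v = 0"
proof -
  have gen: "gen x \<in> carrier (free_alg Sbar2)" if "x \<in> L" for x
    using that assms(1) by (auto simp: gen_def)
  have sgl: "Poly_Mapping.single 0 c \<in> carrier (free_alg Sbar2)" for c
    by simp
  have [simp]: "free_act scale rho (gen x) w = rho x w" for x w
    by (simp add: gen_def free_act_single)
  have S: "x \<in> Sbar2" if "x \<in> L" for x using that assms(1) by auto
  consider
      (add) x y where "x \<in> L" "y \<in> L" "r = gen (x + y) - gen x - gen y"
    | (scale) c x where "x \<in> L" "r = gen (vf_scale c x) - Poly_Mapping.single 0 c * gen x"
    | (bracket) x y where "x \<in> L" "y \<in> L" "r = gen x * gen y - gen y * gen x - gen (vf_bracket x y)"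
    using assms(2) unfolding env_relations_def by blast
  then show ?thesis
  proof cases
    case add
    then show ?thesis by (simp only: free_act_diff) (simp add: S rho_add_left)
  next
    case scale
    then show ?thesis
      by (simp only: free_act_diff free_act_mult[OF sgl]) (simp add: S free_act_single rho_scale_left)
  next
    case bracket
    then show ?thesis
      by (simp only: free_act_diff free_act_mult[OF gen]) (simp add: S rho_bracket)
  qed
qed

lemma env_act_coset:
  assumes L: "L \<subseteq> Sbar2" "vf.subspace L"
      "\<And>X Y. X \<in> L \<Longrightarrow> Y \<in> L \<Longrightarrow> vf_bracket X Y \<in> L"
    and f: "f \<in> carrier (free_alg L)"
  shows "env_act scale rho (env_ideal vf_scale vf_bracket L +>\<^bsub>free_alg L\<^esub> f) v =
           free_act scale rho f v"
proof -
  let ?I = "env_ideal vf_scale vf_bracket L"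
  let ?K = "{h \<in> carrier (free_alg L). \<forall>v. free_act scale rho h v = 0}"
  interpret R: ring "free_alg L" by (rule free_alg_ring)
  have rel: "env_relations vf_scale vf_bracket L \<subseteq> carrier (free_alg L)"
    using L by (intro env_relations_carrier) (auto intro: vf.subspace_add vf.subspace_scale)
  have sub: "h \<in> carrier (free_alg Sbar2)" if "h \<in> carrier (free_alg L)" for h
    using that L(1) by (auto simp: free_alg_carrier)
  have inv: "\<ominus>\<^bsub>free_alg L\<^esub> h = - h" if "h \<in> carrier (free_alg L)" for h
    by (rule R.minus_equality) (use that in \<open>simp_all add: free_alg_uminus\<close>)
  have "ideal ?K (free_alg L)"
  proof (rule idealI[OF free_alg_ring])
    show "subgroup ?K (add_monoid (free_alg L))"
      using free_act_diff[of 0]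
      by (intro R.add.subgroupI)
        (auto simp: free_act_add inv free_alg_uminus free_alg_add free_alg_carrier[of 0]
          intro: exI[of _ 0])
  qed (auto simp: free_act_mult sub free_alg_mult free_act_zero_right)
  then have "?I \<subseteq> ?K"
    unfolding env_ideal_def
    by (rule R.genideal_minimal) (use rel env_relations_act[OF L(1)] in auto)
  moreover have "ideal ?I (free_alg L)"
    unfolding env_ideal_def using rel by (rule R.genideal_ideal)
  then have "0 \<in> ?I"
    using additive_subgroup.zero_closed[OF ideal.axioms(1)] by fastforce
  moreover have coset_eq: "?I +>\<^bsub>free_alg L\<^esub> f = (\<lambda>h. h + f) ` ?I"
    by (auto simp: a_r_coset_def')
  ultimately have same: "free_act scale rho g v = free_act scale rho f v"
    if "g \<in> ?I +>\<^bsub>free_alg L\<^esub> f" for g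
    using that by (auto simp: free_act_add)
  have mem: "f \<in> ?I +>\<^bsub>free_alg L\<^esub> f"
    unfolding coset_eq by (rule image_eqI[OF _ \<open>0 \<in> ?I\<close>]) simp
  show ?thesis
    unfolding env_act_def
  proof (rule the_equality)
    show "\<forall>g \<in> ?I +>\<^bsub>free_alg L\<^esub> f. free_act scale rho f v = free_act scale rho g v"
      using same by metis
  next
    fix y assume "\<forall>g \<in> ?I +>\<^bsub>free_alg L\<^esub> f. y = free_act scale rho g v"
    then show "y = free_act scale rho f v" using mem by blast
  qed
qed

lemma env_act_coset_cartan:
  assumes "f \<in> carrier (free_alg cartan)"
  shows "env_act scale rho (env_ideal vf_scale vf_bracket cartan +>\<^bsub>free_alg cartan\<^esub> f) v =
           free_act scale rho f v"
proof (rule env_act_coset[OF cartan_subset_Sbar2 _ _ assms])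
  show "vf.subspace cartan" unfolding cartan_def by (rule vf.subspace_span)
  then show "vf_bracket X Y \<in> cartan" if "X \<in> cartan" "Y \<in> cartan" for X Y
    using that by (simp add: cartan_bracket vf.subspace_0)
qed

end

locale Omega_one = Sbar2_module +
  assumes locally_finite:
      "\<exists>B. finite B \<and> v \<in> span B \<and> (\<forall>X \<in> Delta2. \<forall>w \<in> span B. rho X w \<in> span B)"
    and generalized_eigen:
      "X \<in> Delta2 \<Longrightarrow> \<exists>k. ((\<lambda>w. rho X w - scale (phi_one X) w) ^^ k) v = 0"
    and finite_dim_Wh: "\<exists>B. finite B \<and> span B = Wh_one"

text \<open>Existence of a finite basis over \<open>U(\<hh>)\<close>: every vector is a \<open>U(\<hh>)\<close>-linear
  combination of the basis elements with unique coefficients.\<close>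

definition free_finite_rank_over_U_cartan ::
  "(complex \<Rightarrow> 'm \<Rightarrow> 'm) \<Rightarrow> (vfield \<Rightarrow> 'm \<Rightarrow> 'm::ab_group_add) \<Rightarrow> bool" where
  "free_finite_rank_over_U_cartan sc rho \<longleftrightarrow>
     (\<exists>B. finite B \<and>
        (\<forall>v. \<exists>!u. u \<in> B \<rightarrow>\<^sub>E carrier U_cartan \<and> v = (\<Sum>b \<in> B. env_act sc rho (u b) b)))"

end

theory Submission
  imports Defs
begin

text \<open>
The four fields \<open>\<partial>\<^sub>1, \<partial>\<^sub>2, d\<^sub>1, d\<^sub>2\<close> already determine the structure of \<open>M\<close> over \<open>U(\<hh>)\<close>.
Since \<open>[\<partial>\<^sub>i, d\<^sub>i] = \<partial>\<^sub>i\<close>, that is \<open>\<partial>\<^sub>i d\<^sub>i = (d\<^sub>i + 1) \<partial>\<^sub>i\<close>, one has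
\<open>\<partial>\<^sub>i f(d\<^sub>i) w = f(d\<^sub>i + 1) w\<close> for every polynomial \<open>f\<close> and every \<open>w\<close> fixed by \<open>\<partial>\<^sub>i\<close>. So
\<open>\<partial>\<^sub>i - 1\<close> acts on polynomials in \<open>d\<^sub>i\<close> as the forward difference operator, which lowers binomial
coefficients: \<open>(\<partial>\<^sub>i - 1) (d\<^sub>i choose (a + 1)) w = (d\<^sub>i choose a) w\<close>.

For one index, local nilpotency of \<open>\<partial>\<^sub>i - 1\<close> turns this into a Newton expansion: each vector is
\<open>\<Sum>\<^sub>a (d\<^sub>i choose a) x\<^sub>a\<close> with unique \<open>x\<^sub>a\<close> fixed by \<open>\<partial>\<^sub>i\<close> (\<open>binom_sum_exists\<close>,
\<open>binom_sum_eq_0\<close>). As \<open>\<partial>\<^sub>2\<close> and \<open>d\<^sub>2\<close> commute with \<open>\<partial>\<^sub>1\<close>, they preserve the fixed space of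
\<open>\<partial>\<^sub>1\<close>, and expanding there once more gives
\<open>M = \<Oplus>\<^sub>i\<^sub>j (d\<^sub>1 choose i) (d\<^sub>2 choose j) Wh\<^sub>\<one>(M)\<close> (\<open>Wh_one_generates\<close>,
\<open>Wh_one_binom_independent\<close>). Hence a basis of the finite-dimensional space \<open>Wh\<^sub>\<one>(M)\<close> is a basis
of \<open>M\<close> over \<open>\<complex>[d\<^sub>1, d\<^sub>2]\<close>.

It remains to pass from \<open>\<complex>[d\<^sub>1, d\<^sub>2]\<close> to \<open>U(\<hh>)\<close>. For the uniqueness of coefficients it is
enough that the products of binomials span \<open>U(\<hh>)\<close> (\<open>carrier_binom_expansion\<close>): a relation among
basis vectors, written in these products, has vanishing coefficients by the direct sum above, so
the elements of \<open>U(\<hh>)\<close> that occur in it vanish.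
\<close>

section \<open>Binomial coefficients of an operator\<close>

text \<open>The operator \<open>(D choose a)\<close>, from \<open>(a + 1) (D choose (a + 1)) = (D - a) (D choose a)\<close>.
The scalar multiplication is a parameter because \<open>D\<close> will be the action of \<open>d\<^sub>i\<close> on the module and
also left multiplication by the generator \<open>d\<^sub>i\<close> of the free algebra.\<close>

primrec choose_op :: "(complex \<Rightarrow> 'v \<Rightarrow> 'v) \<Rightarrow> ('v \<Rightarrow> 'v) \<Rightarrow> nat \<Rightarrow> 'v \<Rightarrow> 'v::ab_group_add" where
  "choose_op sc D 0 v = v"
| "choose_op sc D (Suc a) v =
     sc (1 / of_nat (Suc a)) (D (choose_op sc D a v) - sc (of_nat a) (choose_op sc D a v))"

lemma choose_op_intertwine:
  assumes "\<And>x y. \<phi> (x - y) = \<phi> x - \<phi> y" "\<And>c x. \<phi> (sc c x) = sc' c (\<phi> x)"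
    and "\<And>x. \<phi> (D x) = D' (\<phi> x)"
  shows "\<phi> (choose_op sc D a v) = choose_op sc' D' a (\<phi> v)"
  by (induction a) (simp_all add: assms)

lemma choose_op_closed:
  assumes "\<And>x y. x \<in> S \<Longrightarrow> y \<in> S \<Longrightarrow> x - y \<in> S" "\<And>c x. x \<in> S \<Longrightarrow> sc c x \<in> S"
    and "\<And>x. x \<in> S \<Longrightarrow> D x \<in> S" and "v \<in> S"
  shows "choose_op sc D a v \<in> S"
  by (induction a) (simp_all add: assms)

lemma apply_choose_op:
  assumes "vector_space sc"
  shows "D (choose_op sc D a v) =
     sc (of_nat (Suc a)) (choose_op sc D (Suc a) v) + sc (of_nat a) (choose_op sc D a v)"
proof -
  interpret vector_space sc by (fact assms)
  show ?thesis by (simp del: of_nat_Suc)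
qed

lemma linear_choose_op:
  assumes "Vector_Spaces.linear sc sc D"
  shows "Vector_Spaces.linear sc sc (choose_op sc D a)"
proof -
  interpret D: Vector_Spaces.linear sc sc D by (fact assms)
  show ?thesis
  proof (unfold_locales, goal_cases)
    case (1 x y)
    show ?case
      by (induction a)
        (simp_all add: D.add D.vs1.scale_right_distrib D.vs1.scale_right_diff_distrib)
  next
    case (2 c x)
    show ?case
      by (induction a) (simp_all add: D.scale D.vs1.scale_right_diff_distrib mult.commute)
  qed
qed

section \<open>Newton expansion with respect to a shifted operator\<close>

text \<open>The relation says \<open>E D = (D + 1) E\<close>; the model is \<open>E = \<partial>\<^sub>i\<close>, \<open>D = d\<^sub>i\<close>.\<close>

locale shift_pair = vector_space scale +
  E: Vector_Spaces.linear scale scale E + D: Vector_Spaces.linear scale scale D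
  for scale :: "complex \<Rightarrow> 'v::ab_group_add \<Rightarrow> 'v" and E D :: "'v \<Rightarrow> 'v" +
  assumes E_D: "E (D v) = D (E v) + E v"
begin

abbreviation binom :: "nat \<Rightarrow> 'v \<Rightarrow> 'v" where
  "binom \<equiv> choose_op scale D"

text \<open>Pascal's rule \<open>(D + 1 choose a + 1) = (D choose a + 1) + (D choose a)\<close>: on a fixed vector of
\<open>E\<close>, applying \<open>E\<close> replaces \<open>D\<close> by \<open>D + 1\<close>.\<close>

lemma E_binom_Suc:
  assumes "E v = v"
  shows "E (binom (Suc a) v) = binom (Suc a) v + binom a v"
proof (induction a)
  case 0
  then show ?case by (simp add: E_D assms)
next
  case (Suc a)
  let ?n = "of_nat (Suc a) :: complex"
  let ?x = "binom (Suc a) v" and ?y = "binom a v"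
  have "D ?y = scale ?n ?x + scale (of_nat a) ?y" by (rule apply_choose_op) unfold_locales
  have n: "scale ?n w = scale (of_nat a) w + w" for w
    by (simp only: of_nat_Suc scale_left_distrib scale_one ac_simps)
  have n': "scale (of_nat (Suc (Suc a))) w = scale (of_nat a) w + w + w" for w
    by (simp only: of_nat_Suc scale_left_distrib scale_one ac_simps)
  have "E (D ?x - scale ?n ?x) = (D ?x - scale ?n ?x) + scale (of_nat (Suc (Suc a))) ?x"
    unfolding E.diff E_D E.scale E.add Suc D.add \<open>D ?y = _\<close> n n' scale_right_distrib
    by (simp add: algebra_simps del: choose_op.simps)
  then show ?case
    unfolding choose_op.simps(2)[of _ _ "Suc a"] E.scale
    by (simp add: scale_right_distrib del: choose_op.simps of_nat_Suc)
qed

text \<open>Applying \<open>E - 1\<close> removes the term \<open>a = 0\<close> and shifts the others down by one, so the induction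
hypothesis kills all \<open>x a\<close> with \<open>a > 0\<close>, and then the sum is just \<open>x 0\<close>.\<close>

lemma binom_sum_eq_0:
  assumes "\<And>a. E (x a) = x a" and "(\<Sum>a<n. binom a (x a)) = 0" and "a < n"
  shows "x a = 0"
  using assms
proof (induction n arbitrary: x a)
  case (Suc n)
  have sum: "x 0 + (\<Sum>a<n. binom (Suc a) (x (Suc a))) = 0"
    using Suc.prems(2) by (simp add: sum.lessThan_Suc_shift del: sum.lessThan_Suc choose_op.simps(2))
  have "0 = E (x 0 + (\<Sum>a<n. binom (Suc a) (x (Suc a))))"
    by (simp only: sum E.zero)
  also have "\<dots> = (x 0 + (\<Sum>a<n. binom (Suc a) (x (Suc a)))) + (\<Sum>a<n. binom a (x (Suc a)))"
    by (simp add: E.add E.sum E_binom_Suc Suc.prems(1) sum.distrib algebra_simps del: choose_op.simps)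
  finally have "(\<Sum>a<n. binom a (x (Suc a))) = 0" by (simp only: sum) simp
  then have tail: "x (Suc a) = 0" if "a < n" for a
    using Suc.IH[of "\<lambda>a. x (Suc a)" a] Suc.prems(1) that by blast
  interpret b: Vector_Spaces.linear scale scale "binom m" for m
    by (rule linear_choose_op) unfold_locales
  have "x 0 = 0" using sum by (simp add: tail b.zero del: choose_op.simps)
  then show ?case using tail Suc.prems(3) by (cases a) auto
qed simp

text \<open>Expand \<open>(E - 1) v\<close>, which is closer to being killed, and integrate: raising every binomial by
one gives a vector with the same difference, so it differs from \<open>v\<close> by a vector \<open>r\<close> fixed by
\<open>E\<close>, which becomes the constant term. The invariant subspace \<open>S\<close> allows the expansion to be
iterated inside the fixed space of a second, commuting operator.\<close>

lemma binom_sum_exists: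
  assumes S: "subspace S" "\<And>w. w \<in> S \<Longrightarrow> E w \<in> S" "\<And>w. w \<in> S \<Longrightarrow> D w \<in> S"
    and "v \<in> S" "((\<lambda>w. E w - w) ^^ k) v = 0"
  shows "\<exists>x. (\<forall>a. x a \<in> S \<and> E (x a) = x a) \<and> v = (\<Sum>a<k. binom a (x a))"
  using assms(4,5)
proof (induction k arbitrary: v)
  case 0
  then show ?case using subspace_0[OF S(1)] by (intro exI[of _ "\<lambda>_. 0"]) (simp add: E.zero)
next
  case (Suc k)
  have "E v - v \<in> S" using Suc.prems(1) by (intro subspace_diff S)
  moreover have "((\<lambda>w. E w - w) ^^ k) (E v - v) = 0"
    using Suc.prems(2) by (simp only: funpow_Suc_right o_def)
  ultimately obtain x where x: "\<And>a. x a \<in> S" "\<And>a. E (x a) = x a"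
      and v: "E v - v = (\<Sum>a<k. binom a (x a))"
    using Suc.IH by blast
  define r where "r = v - (\<Sum>a<k. binom (Suc a) (x a))"
  have "binom a (x b) \<in> S" for a b
    by (rule choose_op_closed) (auto intro: subspace_diff subspace_scale S x)
  then have "r \<in> S"
    unfolding r_def by (intro subspace_diff subspace_sum S Suc.prems)
  moreover have "E r = r"
    using v unfolding r_def
    by (simp add: E.diff E.sum E_binom_Suc x sum.distrib algebra_simps del: choose_op.simps)
  moreover have "v = (\<Sum>a<Suc k. binom a (case a of 0 \<Rightarrow> r | Suc b \<Rightarrow> x b))"
    by (simp add: sum.lessThan_Suc_shift r_def del: sum.lessThan_Suc choose_op.simps(2))
  ultimately show ?case
    using x by (intro exI[of _ "\<lambda>a. case a of 0 \<Rightarrow> r | Suc b \<Rightarrow> x b"]) (auto split: nat.splits)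
qed

end

section \<open>A spanning set of the enveloping algebra of the Cartan subalgebra\<close>

abbreviation fa_scale :: "complex \<Rightarrow> 'g free_alg \<Rightarrow> 'g free_alg" where
  "fa_scale c f \<equiv> Poly_Mapping.single 0 c * f"

lemma free_alg_decomp:
  "h = (\<Sum>w \<in> Poly_Mapping.keys h. Poly_Mapping.single w (Poly_Mapping.lookup h w))"
  for h :: "'g free_alg"
  by (rule poly_mapping_eqI)
    (auto simp: lookup_sum lookup_single when_def in_keys_iff sum.delta)

text \<open>Scalars sit on the empty word, and concatenation with it changes nothing on either side.\<close>

lemma fa_scale_central: "fa_scale c f = f * Poly_Mapping.single 0 c" for f :: "'g free_alg"
  by (subst (1 2) free_alg_decomp[of f])
    (simp add: sum_distrib_left sum_distrib_right mult_single mult.commute)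

lemma mult_fa_scale: "f * fa_scale c g = fa_scale c (f * g)" for f g :: "'g free_alg"
  by (metis fa_scale_central mult.assoc)

interpretation fa: vector_space fa_scale
  by unfold_locales
    (auto simp: algebra_simps single_add mult_single single_one simp flip: mult.assoc)

lemma fa_linear_mult: "Vector_Spaces.linear fa_scale fa_scale ((*) g)" for g :: "'g free_alg"
  by unfold_locales (auto simp: algebra_simps mult_fa_scale)

definition cartan_ideal :: "vfield free_alg set" where
  "cartan_ideal = env_ideal vf_scale vf_bracket cartan"

definition binom_elt :: "nat \<Rightarrow> nat \<Rightarrow> vfield free_alg" where
  "binom_elt i j =
     choose_op fa_scale ((*) (gen d1)) i (choose_op fa_scale ((*) (gen d2)) j 1)"

lemma d1_cartan: "d1 \<in> cartan" and d2_cartan: "d2 \<in> cartan"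
  by (auto simp: cartan_def intro: vf.span_base)

lemma subspace_cartan: "vf.subspace cartan"
  unfolding cartan_def by (rule vf.subspace_span)

lemma cartan_relations_carrier:
  "env_relations vf_scale vf_bracket cartan \<subseteq> carrier (free_alg cartan)"
  by (rule env_relations_carrier)
    (auto intro: vf.subspace_add[OF subspace_cartan] vf.subspace_scale[OF subspace_cartan]
      simp: cartan_bracket vf.subspace_0[OF subspace_cartan])

lemma ideal_cartan_ideal: "ideal cartan_ideal (free_alg cartan)"
  unfolding cartan_ideal_def env_ideal_def
  by (rule ring.genideal_ideal[OF free_alg_ring cartan_relations_carrier])

lemma cartan_ideal_lmult:
  "x \<in> cartan_ideal \<Longrightarrow> f \<in> carrier (free_alg cartan) \<Longrightarrow> f * x \<in> cartan_ideal"
  using ideal.I_l_closed[OF ideal_cartan_ideal] by simp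

lemma cartan_ideal_rmult:
  "x \<in> cartan_ideal \<Longrightarrow> f \<in> carrier (free_alg cartan) \<Longrightarrow> x * f \<in> cartan_ideal"
  using ideal.I_r_closed[OF ideal_cartan_ideal] by simp

lemma cartan_ideal_scale: "x \<in> cartan_ideal \<Longrightarrow> fa_scale c x \<in> cartan_ideal"
  by (rule cartan_ideal_lmult) auto

lemma subspace_cartan_ideal: "fa.subspace cartan_ideal"
  using additive_subgroup.a_closed[OF ideal.axioms(1)[OF ideal_cartan_ideal]]
    additive_subgroup.zero_closed[OF ideal.axioms(1)[OF ideal_cartan_ideal]]
  by (intro fa.subspaceI cartan_ideal_scale) simp_all

lemmas cartan_ideal_add = fa.subspace_add[OF subspace_cartan_ideal]
lemmas cartan_ideal_diff = fa.subspace_diff[OF subspace_cartan_ideal]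

lemma cartan_coset_eq:
  assumes "f \<in> carrier (free_alg cartan)" "g \<in> carrier (free_alg cartan)" "f - g \<in> cartan_ideal"
  shows "cartan_ideal +>\<^bsub>free_alg cartan\<^esub> f = cartan_ideal +>\<^bsub>free_alg cartan\<^esub> g"
proof -
  interpret ring "free_alg cartan" by (rule free_alg_ring)
  have "f \<in> cartan_ideal +>\<^bsub>free_alg cartan\<^esub> g"
    using assms(3) by (auto simp: a_r_coset_def' intro!: bexI[of _ "f - g"])
  then show ?thesis
    using a_repr_independence[OF _ assms(2)]
      additive_subgroup.a_subgroup[OF ideal.axioms(1)[OF ideal_cartan_ideal]] by blast
qed

lemma cartan_relation:
  "r \<in> env_relations vf_scale vf_bracket cartan \<Longrightarrow> r \<in> cartan_ideal"
  unfolding cartan_ideal_def env_ideal_def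
  using ring.genideal_self[OF free_alg_ring cartan_relations_carrier] by blast

lemma gen_cartan_carrier: "x \<in> cartan \<Longrightarrow> gen x \<in> carrier (free_alg cartan)"
  by (simp add: gen_def)

lemma gen_add_mod_ideal:
  "x \<in> cartan \<Longrightarrow> y \<in> cartan \<Longrightarrow> gen (x + y) - gen x - gen y \<in> cartan_ideal"
  by (rule cartan_relation[unfolded env_relations_def]) blast

lemma gen_scale_mod_ideal:
  "x \<in> cartan \<Longrightarrow> gen (vf_scale c x) - fa_scale c (gen x) \<in> cartan_ideal"
  by (rule cartan_relation[unfolded env_relations_def]) blast

text \<open>The Cartan subalgebra is abelian, so the bracket relation reads \<open>x y - y x = gen 0\<close>. In the free
algebra on a set, \<open>gen 0\<close> is a nonzero word; it vanishes modulo the ideal by homogeneity.\<close>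

lemma gen_commute_mod_ideal:
  assumes "x \<in> cartan" "y \<in> cartan"
  shows "gen x * gen y - gen y * gen x \<in> cartan_ideal"
proof -
  have "gen x * gen y - gen y * gen x - gen (vf_bracket x y) \<in> cartan_ideal"
    by (rule cartan_relation[unfolded env_relations_def]) (use assms in blast)
  moreover have "gen (0 :: vfield) \<in> cartan_ideal"
    using gen_scale_mod_ideal[OF d1_cartan, of 0] by simp
  ultimately show ?thesis
    using cartan_ideal_add[of "gen x * gen y - gen y * gen x - gen 0" "gen 0"] assms
    by (simp add: cartan_bracket)
qed

lemma gen_cartan_mod_ideal:
  assumes "x \<in> cartan"
  shows "\<exists>a b. gen x - (fa_scale a (gen d1) + fa_scale b (gen d2)) \<in> cartan_ideal"
proof -
  obtain a b where x: "x = vf_scale a d1 + vf_scale b d2"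
    using assms unfolding cartan_def vf.span_insert vf.span_empty
    by (auto simp: algebra_simps)
  have c: "vf_scale a d1 \<in> cartan" "vf_scale b d2 \<in> cartan"
    by (simp_all add: vf.subspace_scale[OF subspace_cartan] d1_cartan d2_cartan)
  have "(gen x - gen (vf_scale a d1) - gen (vf_scale b d2))
      + ((gen (vf_scale a d1) - fa_scale a (gen d1)) + (gen (vf_scale b d2) - fa_scale b (gen d2)))
      \<in> cartan_ideal"
    unfolding x using c
    by (intro cartan_ideal_add gen_add_mod_ideal gen_scale_mod_ideal d1_cartan d2_cartan)
  then show ?thesis by (intro exI[of _ a] exI[of _ b]) (simp add: algebra_simps)
qed

lemma choose_op_carrier:
  "x \<in> cartan \<Longrightarrow> f \<in> carrier (free_alg cartan) \<Longrightarrow>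
     choose_op fa_scale ((*) (gen x)) i f \<in> carrier (free_alg cartan)"
  by (rule choose_op_closed) (auto intro: free_alg_diff free_alg_mult gen_cartan_carrier)

text \<open>An element commuting with \<open>gen x\<close> modulo a two-sided ideal commutes with every polynomial in
\<open>gen x\<close>; here the polynomial is a binomial.\<close>

lemma gen_choose_op_commute_mod_ideal:
  assumes "x \<in> cartan" "y \<in> cartan" "f \<in> carrier (free_alg cartan)"
  shows "gen y * choose_op fa_scale ((*) (gen x)) i f
           - choose_op fa_scale ((*) (gen x)) i (gen y * f) \<in> cartan_ideal"
proof (induction i)
  case 0
  show ?case using fa.subspace_0[OF subspace_cartan_ideal] by simp
next
  case (Suc i)
  let ?Q = "choose_op fa_scale ((*) (gen x)) i"
  have "gen y * choose_op fa_scale ((*) (gen x)) (Suc i) f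
           - choose_op fa_scale ((*) (gen x)) (Suc i) (gen y * f)
      = fa_scale (1 / of_nat (Suc i)) ((gen y * gen x - gen x * gen y) * ?Q f
          + gen x * (gen y * ?Q f - ?Q (gen y * f))
          - fa_scale (of_nat i) (gen y * ?Q f - ?Q (gen y * f)))"
    by (simp add: mult_fa_scale[of "gen y"] algebra_simps del: of_nat_Suc single_of_nat)
  moreover have "\<dots> \<in> cartan_ideal"
    by (rule cartan_ideal_scale[OF cartan_ideal_diff[OF cartan_ideal_add]])
      (fact cartan_ideal_rmult[OF gen_commute_mod_ideal[OF assms(2,1)]
              choose_op_carrier[OF assms(1,3)]]
            cartan_ideal_lmult[OF Suc gen_cartan_carrier[OF assms(1)]] cartan_ideal_scale[OF Suc])+
  ultimately show ?case by simp
qed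

text \<open>Including the ideal among the generators makes congruences modulo the ideal into plain
memberships.\<close>

definition binom_span :: "vfield free_alg set" where
  "binom_span = fa.span (range (case_prod binom_elt) \<union> cartan_ideal)"

lemma binom_elt_in_span: "binom_elt i j \<in> binom_span"
  unfolding binom_span_def by (rule fa.span_base)
    (use rangeI[of "case_prod binom_elt" "(i, j)"] in simp)

lemma ideal_in_span: "f \<in> cartan_ideal \<Longrightarrow> f \<in> binom_span"
  unfolding binom_span_def by (rule fa.span_base) auto

lemma subspace_binom_span: "fa.subspace binom_span"
  unfolding binom_span_def by (rule fa.subspace_span)

lemma gen_d1_binom_elt: "gen d1 * binom_elt i j \<in> binom_span"
  unfolding binom_elt_def apply_choose_op[OF fa.vector_space_axioms]
  unfolding binom_elt_def[symmetric]
  by (intro fa.subspace_add fa.subspace_scale subspace_binom_span binom_elt_in_span)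

text \<open>In \<open>binom_elt\<close> the \<open>d\<^sub>1\<close> factor stands on the left, so \<open>gen d2\<close> has to be moved past it before
the recursion for \<open>(d\<^sub>2 choose j)\<close> applies.\<close>

lemma gen_d2_binom_elt: "gen d2 * binom_elt i j \<in> binom_span"
proof -
  let ?C1 = "choose_op fa_scale ((*) (gen d1)) i"
  let ?C2 = "\<lambda>j. choose_op fa_scale ((*) (gen d2)) j 1"
  interpret C1: Vector_Spaces.linear fa_scale fa_scale ?C1
    by (rule linear_choose_op[OF fa_linear_mult])
  have "?C2 j \<in> carrier (free_alg cartan)"
    by (intro choose_op_carrier d2_cartan) (simp add: free_alg_carrier)
  then have "gen d2 * ?C1 (?C2 j) - ?C1 (gen d2 * ?C2 j) \<in> cartan_ideal"
    by (intro gen_choose_op_commute_mod_ideal d1_cartan d2_cartan)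
  moreover have "?C1 (gen d2 * ?C2 j) =
      fa_scale (of_nat (Suc j)) (binom_elt i (Suc j)) + fa_scale (of_nat j) (binom_elt i j)"
    unfolding apply_choose_op[OF fa.vector_space_axioms] C1.add C1.scale binom_elt_def by (rule refl)
  then have "?C1 (gen d2 * ?C2 j) \<in> binom_span"
    by (auto intro!: fa.subspace_add fa.subspace_scale subspace_binom_span binom_elt_in_span
        simp del: of_nat_Suc single_of_nat)
  ultimately have "(gen d2 * ?C1 (?C2 j) - ?C1 (gen d2 * ?C2 j)) + ?C1 (gen d2 * ?C2 j) \<in> binom_span"
    by (rule fa.subspace_add[OF subspace_binom_span ideal_in_span])
  then show ?thesis by (simp add: binom_elt_def)
qed

lemma binom_span_mult:
  assumes g: "g \<in> carrier (free_alg cartan)" "\<And>i j. g * binom_elt i j \<in> binom_span"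
    and "f \<in> binom_span"
  shows "g * f \<in> binom_span"
proof -
  interpret g: Vector_Spaces.linear fa_scale fa_scale "(*) g"
    by (rule fa_linear_mult)
  have "(*) g ` binom_span \<subseteq> binom_span"
    unfolding binom_span_def g.span_image[symmetric]
    unfolding binom_span_def[symmetric]
    by (rule fa.span_minimal[OF _ subspace_binom_span])
      (auto intro: g ideal_in_span cartan_ideal_lmult)
  then show ?thesis using assms(3) by auto
qed

text \<open>The span contains \<open>1\<close> and is stable under left multiplication by \<open>gen d1\<close> and \<open>gen d2\<close>; modulo
the ideal, every letter is a combination of these two, so every word is reached.\<close>

lemma carrier_subset_binom_span: "carrier (free_alg cartan) \<subseteq> binom_span"
proof
  fix h assume h: "h \<in> carrier (free_alg cartan)"
  have word: "Poly_Mapping.single (Word xs) 1 \<in> binom_span" if "set xs \<subseteq> cartan" for xs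
    using that
  proof (induction xs)
    case Nil
    have "Poly_Mapping.single (Word []) 1 = binom_elt 0 0"
      by (simp add: binom_elt_def flip: zero_word_def)
    then show ?case using binom_elt_in_span by metis
  next
    case (Cons x xs)
    let ?w = "Poly_Mapping.single (Word xs) 1 :: vfield free_alg"
    have w: "?w \<in> binom_span" "?w \<in> carrier (free_alg cartan)"
      using Cons by auto
    have "x \<in> cartan" using Cons.prems by simp
    obtain a b where ab: "gen x - (fa_scale a (gen d1) + fa_scale b (gen d2)) \<in> cartan_ideal"
      using gen_cartan_mod_ideal[OF \<open>x \<in> cartan\<close>] by blast
    have "Poly_Mapping.single (Word (x # xs)) 1 = gen x * ?w"
      by (simp add: gen_def mult_single plus_word_def)
    also have "\<dots> = (gen x - (fa_scale a (gen d1) + fa_scale b (gen d2))) * ?w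
        + (fa_scale a (gen d1 * ?w) + fa_scale b (gen d2 * ?w))"
      by (simp add: algebra_simps)
    also have "\<dots> \<in> binom_span"
    proof (rule fa.subspace_add[OF subspace_binom_span ideal_in_span[OF cartan_ideal_rmult[OF ab w(2)]]])
      have "gen d1 * ?w \<in> binom_span" "gen d2 * ?w \<in> binom_span"
        using binom_span_mult[OF gen_cartan_carrier[OF d1_cartan] gen_d1_binom_elt w(1)]
          binom_span_mult[OF gen_cartan_carrier[OF d2_cartan] gen_d2_binom_elt w(1)] .
      then show "fa_scale a (gen d1 * ?w) + fa_scale b (gen d2 * ?w) \<in> binom_span"
        by (intro fa.subspace_add fa.subspace_scale subspace_binom_span)
    qed
    finally show ?case .
  qed
  have "(\<Sum>w \<in> Poly_Mapping.keys h. fa_scale (Poly_Mapping.lookup h w)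
      (Poly_Mapping.single (Word (letters w)) 1)) \<in> binom_span"
    using h by (intro fa.subspace_sum fa.subspace_scale subspace_binom_span word)
      (auto simp: free_alg_carrier)
  then show "h \<in> binom_span"
    by (subst free_alg_decomp) (simp add: mult_single)
qed

text \<open>The coefficients have finite support; quantifying over all large \<open>n\<close> expresses this and lets
several expansions be truncated at one common \<open>n\<close>.\<close>

lemma carrier_binom_expansion:
  assumes "h \<in> carrier (free_alg cartan)"
  shows "\<exists>c. eventually (\<lambda>n. h - (\<Sum>i<n. \<Sum>j<n. fa_scale (c i j) (binom_elt i j)) \<in> cartan_ideal)
               sequentially"
proof -
  have "h \<in> fa.span (range (case_prod binom_elt) \<union> cartan_ideal)"
    using assms carrier_subset_binom_span by (auto simp: binom_span_def)
  then show ?thesis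
  proof (induction rule: fa.span_induct_alt)
    case base
    show ?case
      using fa.subspace_0[OF subspace_cartan_ideal] by (intro exI[of _ "\<lambda>_ _. 0"]) simp
  next
    case (step e f g)
    obtain c where c: "eventually (\<lambda>n. g - (\<Sum>i<n. \<Sum>j<n. fa_scale (c i j) (binom_elt i j))
        \<in> cartan_ideal) sequentially"
      using step.IH by blast
    show ?case
    proof (cases "f \<in> cartan_ideal")
      case True
      from c show ?thesis
        by (intro exI[of _ c], elim eventually_mono)
          (use cartan_ideal_add[OF cartan_ideal_scale[OF True]] in \<open>simp add: add_diff_eq[symmetric]\<close>)
    next
      case False
      then obtain k l where f: "f = binom_elt k l" using step.hyps by auto
      let ?c = "\<lambda>i j. c i j + (if i = k then if j = l then e else 0 else 0)"
      have sum_eq: "(\<Sum>i<n. \<Sum>j<n. fa_scale (?c i j) (binom_elt i j)) =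
          (\<Sum>i<n. \<Sum>j<n. fa_scale (c i j) (binom_elt i j)) + fa_scale e f"
        if "n > max k l" for n
      proof -
        have "(\<Sum>j<n. fa_scale (if i = k then if j = l then e else 0 else 0) (binom_elt i j))
            = (if i = k then fa_scale e f else 0)" for i
          using that by (simp add: f if_distrib[of "Poly_Mapping.single _"]
              if_distrib[of "\<lambda>t. t * _"] cong: if_cong)
        then show ?thesis using that
          by (simp only: fa.scale_left_distrib sum.distrib) simp
      qed
      from c eventually_gt_at_top[of "max k l"]
      have "eventually (\<lambda>n. fa_scale e f + g - (\<Sum>i<n. \<Sum>j<n. fa_scale (?c i j) (binom_elt i j))
              \<in> cartan_ideal) sequentially"
      proof eventually_elim
        case (elim n)
        have "a + g - (s + a) = g - s" for a s :: "vfield free_alg" by simp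
        then show ?case using elim(1) by (simp only: sum_eq[OF elim(2)])
      qed
      then show ?thesis by (intro exI[of _ ?c])
    qed
  qed
qed

section \<open>The module over the Cartan subalgebra\<close>

lemma Sbar2_basic: "del1 \<in> Sbar2" "del2 \<in> Sbar2" "d1 \<in> Sbar2" "d2 \<in> Sbar2"
  using d1_cartan d2_cartan cartan_subset_Sbar2 Delta2_subset_Sbar2
  by (auto simp: Delta2_def intro: vf.span_base)

lemma basic_brackets:
  "vf_bracket del1 d1 = del1" "vf_bracket del2 d2 = del2"
  "vf_bracket del1 d2 = 0" "vf_bracket del2 d1 = 0" "vf_bracket del1 del2 = 0"
  by (simp_all add: vf_bracket_def vf_apply_def del1_def del2_def d1_def d2_def var1_def var2_def
      pd1_pCons pd2_def pderiv_pCons one_pCons zero_prod_def)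

context Sbar2_module
begin

lemma linear_rho: "X \<in> Sbar2 \<Longrightarrow> Vector_Spaces.linear scale scale (rho X)"
  by unfold_locales (auto simp: rho_add_right rho_scale_right)

lemma rho_0_left: "rho 0 v = 0"
  using rho_scale_left[OF Sbar2_basic(1), of 0 v] by simp

lemma rho_commute:
  "X \<in> Sbar2 \<Longrightarrow> Y \<in> Sbar2 \<Longrightarrow> vf_bracket X Y = 0 \<Longrightarrow> rho X (rho Y v) = rho Y (rho X v)"
  using rho_bracket[of X Y v] by (simp add: rho_0_left)

lemma shift_pair_rho:
  "X \<in> Sbar2 \<Longrightarrow> Y \<in> Sbar2 \<Longrightarrow> vf_bracket X Y = X \<Longrightarrow> shift_pair scale (rho X) (rho Y)"
  using rho_bracket[of X Y]
  by (intro shift_pair.intro shift_pair_axioms.intro linear_rho vector_space_axioms)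
    (auto simp: algebra_simps)

lemma free_act_gen_mult:
  "X \<in> Sbar2 \<Longrightarrow> free_act scale rho (gen X * f) v = rho X (free_act scale rho f v)"
  by (subst free_act_mult) (simp_all add: gen_def free_act_single)

lemma free_act_fa_scale: "free_act scale rho (fa_scale c f) v = scale c (free_act scale rho f v)"
  by (subst free_act_mult) (simp_all add: free_act_single)

lemma free_act_binom_elt:
  "free_act scale rho (binom_elt i j) v =
     choose_op scale (rho d1) i (choose_op scale (rho d2) j v)"
proof -
  have "free_act scale rho (choose_op fa_scale ((*) (gen X)) k f) v =
      choose_op scale (rho X) k (free_act scale rho f v)" if "X \<in> Sbar2" for X k f
    by (rule choose_op_intertwine) (simp_all add: free_act_diff free_act_fa_scale free_act_gen_mult that)
  moreover have "free_act scale rho 1 v = v"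
    using free_act_single[of 0 1 v] by simp
  ultimately show ?thesis by (simp add: binom_elt_def Sbar2_basic)
qed

text \<open>An element of the ideal represents the zero coset, on which \<open>env_act\<close> can be computed with the
representative \<open>0\<close> as well.\<close>

lemma free_act_cartan_ideal:
  assumes "f \<in> cartan_ideal"
  shows "free_act scale rho f v = 0"
proof -
  have f: "f \<in> carrier (free_alg cartan)" using ideal.Icarr[OF ideal_cartan_ideal assms] .
  have "(0 :: vfield free_alg) \<in> carrier (free_alg cartan)" by (simp add: free_alg_carrier)
  moreover from this have "cartan_ideal +>\<^bsub>free_alg cartan\<^esub> f = cartan_ideal +>\<^bsub>free_alg cartan\<^esub> 0"
    using f assms by (intro cartan_coset_eq) simp_all
  ultimately show ?thesis
    using env_act_coset_cartan[OF f, of v] env_act_coset_cartan[of 0 v]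
    by (simp add: cartan_ideal_def)
qed

end

context Omega_one
begin

interpretation s1: shift_pair scale "rho del1" "rho d1"
  by (rule shift_pair_rho) (simp_all add: Sbar2_basic basic_brackets)

interpretation s2: shift_pair scale "rho del2" "rho d2"
  by (rule shift_pair_rho) (simp_all add: Sbar2_basic basic_brackets)

lemma del_minus_1_locally_nilpotent:
  "\<exists>k. ((\<lambda>w. rho del1 w - w) ^^ k) v = 0" "\<exists>k. ((\<lambda>w. rho del2 w - w) ^^ k) v = 0"
proof -
  have "del1 \<in> Delta2" "del2 \<in> Delta2" by (auto simp: Delta2_def intro: vf.span_base)
  moreover have "phi_one del1 = 1" "phi_one del2 = 1"
    by (simp_all add: phi_one_def del1_def del2_def)
  ultimately show "\<exists>k. ((\<lambda>w. rho del1 w - w) ^^ k) v = 0" "\<exists>k. ((\<lambda>w. rho del2 w - w) ^^ k) v = 0"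
    using generalized_eigen[of del1 v] generalized_eigen[of del2 v] by simp_all
qed

text \<open>Expand a vector in binomials of \<open>d\<^sub>1\<close>, then each coefficient, which lies in the fixed space of
\<open>\<partial>\<^sub>1\<close>, in binomials of \<open>d\<^sub>2\<close>. The second expansion stays in that fixed space, so its coefficients
are fixed by both \<open>\<partial>\<^sub>1\<close> and \<open>\<partial>\<^sub>2\<close>.\<close>

lemma Wh_one_generates:
  assumes S: "subspace S" "\<And>w. w \<in> S \<Longrightarrow> rho d1 w \<in> S" "\<And>w. w \<in> S \<Longrightarrow> rho d2 w \<in> S"
    and Wh: "Wh_one \<subseteq> S"
  shows "v \<in> S"
proof -
  let ?K = "{w. rho del1 w = w}"
  have K: "subspace ?K"
    by (rule subspaceI) (simp_all add: s1.E.zero s1.E.add s1.E.scale)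
  have Kinv: "rho del2 w \<in> ?K" "rho d2 w \<in> ?K" if "w \<in> ?K" for w
    using that rho_commute[of del1 del2 w] rho_commute[of del1 d2 w]
    by (simp_all add: Sbar2_basic basic_brackets)
  have K_S: "w \<in> S" if w: "w \<in> ?K" for w
  proof -
    obtain k where k: "((\<lambda>w. rho del2 w - w) ^^ k) w = 0" using del_minus_1_locally_nilpotent by blast
    have "\<exists>x. (\<forall>b. x b \<in> ?K \<and> rho del2 (x b) = x b) \<and> w = (\<Sum>b<k. s2.binom b (x b))"
      by (rule s2.binom_sum_exists[OF K Kinv w k])
    then obtain x where x: "\<forall>b. x b \<in> ?K \<and> rho del2 (x b) = x b" "w = (\<Sum>b<k. s2.binom b (x b))"
      by (elim exE conjE) (rule that)
    then have "x b \<in> Wh_one" for b by (simp add: Wh_one_def)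
    then have "x b \<in> S" for b using Wh by blast
    then have "s2.binom b (x b) \<in> S" for b
      by (intro choose_op_closed[OF subspace_diff[OF S(1)] subspace_scale[OF S(1)] S(3)])
    then show ?thesis unfolding x(2) by (intro subspace_sum S)
  qed
  obtain k where k: "((\<lambda>w. rho del1 w - w) ^^ k) v = 0" using del_minus_1_locally_nilpotent by blast
  from s1.binom_sum_exists[OF subspace_UNIV UNIV_I UNIV_I UNIV_I k]
  obtain x where x: "\<forall>a. x a \<in> UNIV \<and> rho del1 (x a) = x a" "v = (\<Sum>a<k. s1.binom a (x a))"
    by (elim exE conjE) (rule that)
  then have "x a \<in> S" for a using K_S by simp
  then have "s1.binom a (x a) \<in> S" for a
    by (intro choose_op_closed[OF subspace_diff[OF S(1)] subspace_scale[OF S(1)] S(2)])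
  then show ?thesis unfolding x(2) by (intro subspace_sum S)
qed

text \<open>For each \<open>i\<close> the inner sum over \<open>j\<close> is fixed by \<open>\<partial>\<^sub>1\<close>, since \<open>\<partial>\<^sub>1\<close> commutes with \<open>d\<^sub>2\<close>. Uniqueness
of the expansion in \<open>d\<^sub>1\<close> makes it vanish, and uniqueness of the one in \<open>d\<^sub>2\<close> then gives the claim.\<close>

lemma Wh_one_binom_independent:
  assumes y: "\<And>i j. y i j \<in> Wh_one"
    and sum: "(\<Sum>i<n. \<Sum>j<n. s1.binom i (s2.binom j (y i j))) = 0"
    and "i < n" "j < n"
  shows "y i j = 0"
proof -
  interpret b: Vector_Spaces.linear scale scale "s1.binom m" for m
    by (rule linear_choose_op) unfold_locales
  let ?x = "\<lambda>i. \<Sum>j<n. s2.binom j (y i j)"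
  have "rho del1 (s2.binom j w) = s2.binom j (rho del1 w)" for j w
    by (rule choose_op_intertwine)
      (simp_all add: s1.E.diff s1.E.scale rho_commute Sbar2_basic basic_brackets)
  then have "rho del1 (?x i) = ?x i" for i
    using y by (simp add: s1.E.sum Wh_one_def)
  moreover have "(\<Sum>i<n. s1.binom i (?x i)) = 0"
    using sum by (simp add: b.sum)
  ultimately have "?x i = 0"
    using \<open>i < n\<close> by (rule s1.binom_sum_eq_0)
  moreover have "rho del2 (y i j) = y i j" for j
    using y by (simp add: Wh_one_def)
  ultimately show ?thesis
    using \<open>j < n\<close> by (intro s2.binom_sum_eq_0[of "y i"])
qed

text \<open>The combinations of \<open>B\<close> with coefficients from the free algebra form a subspace stable under
\<open>d\<^sub>1\<close> and \<open>d\<^sub>2\<close> and containing \<open>Wh_one\<close>.\<close>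

lemma Wh_basis_spans:
  assumes "finite B" "span B = Wh_one"
  shows "\<exists>f. (\<forall>b \<in> B. f b \<in> carrier (free_alg cartan)) \<and> v = (\<Sum>b \<in> B. free_act scale rho (f b) b)"
proof -
  let ?S = "{v. \<exists>f. (\<forall>b \<in> B. f b \<in> carrier (free_alg cartan)) \<and>
                    v = (\<Sum>b \<in> B. free_act scale rho (f b) b)}"
  have "v \<in> ?S"
  proof (rule Wh_one_generates)
    show "subspace ?S"
    proof (rule subspaceI)
      show "0 \<in> ?S" by (auto intro!: exI[of _ "\<lambda>_. 0"] simp: free_alg_carrier)
    next
      fix v w assume "v \<in> ?S" "w \<in> ?S"
      then obtain f g where "\<forall>b \<in> B. f b \<in> carrier (free_alg cartan)"
          "v = (\<Sum>b \<in> B. free_act scale rho (f b) b)"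
          "\<forall>b \<in> B. g b \<in> carrier (free_alg cartan)"
          "w = (\<Sum>b \<in> B. free_act scale rho (g b) b)" by blast
      then show "v + w \<in> ?S"
        by (intro CollectI exI[of _ "\<lambda>b. f b + g b"]) (simp add: free_alg_add free_act_add sum.distrib)
    next
      fix c v assume "v \<in> ?S"
      then obtain f where "\<forall>b \<in> B. f b \<in> carrier (free_alg cartan)"
          "v = (\<Sum>b \<in> B. free_act scale rho (f b) b)" by blast
      then show "scale c v \<in> ?S"
        by (intro CollectI exI[of _ "\<lambda>b. fa_scale c (f b)"])
          (simp add: free_alg_mult free_act_fa_scale scale_sum_right)
    qed
    have act: "rho X v \<in> ?S" if X: "X \<in> cartan" and v: "v \<in> ?S" for X v
    proof -
      have S: "X \<in> Sbar2" using X cartan_subset_Sbar2 by auto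
      obtain f where "\<forall>b \<in> B. f b \<in> carrier (free_alg cartan)"
          "v = (\<Sum>b \<in> B. free_act scale rho (f b) b)" using v by blast
      then show ?thesis using X
        by (intro CollectI exI[of _ "\<lambda>b. gen X * f b"])
          (simp add: free_alg_mult gen_cartan_carrier free_act_gen_mult[OF S] rho_sum[OF S])
    qed
    show "rho d1 w \<in> ?S" if "w \<in> ?S" for w by (rule act[OF d1_cartan that])
    show "rho d2 w \<in> ?S" if "w \<in> ?S" for w by (rule act[OF d2_cartan that])
    show "Wh_one \<subseteq> ?S"
    proof
      fix w assume "w \<in> Wh_one"
      then obtain c where "w = (\<Sum>b \<in> B. scale (c b) b)"
        using assms by (auto simp: span_finite)
      then show "w \<in> ?S"
        by (intro CollectI exI[of _ "\<lambda>b. Poly_Mapping.single 0 (c b)"]) (simp add: free_act_single)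
    qed
  qed
  then show ?thesis by simp
qed

text \<open>Writing every \<open>h b\<close> in products of binomials turns the relation into
\<open>\<Sum>\<^sub>i\<^sub>j (d\<^sub>1 choose i) (d\<^sub>2 choose j) y\<^sub>i\<^sub>j = 0\<close> with \<open>y\<^sub>i\<^sub>j = \<Sum>\<^sub>b c\<^sub>b\<^sub>i\<^sub>j b\<close> in \<open>Wh_one\<close>. So all
\<open>y\<^sub>i\<^sub>j\<close> vanish, and with them, \<open>B\<close> being independent, all the coefficients of the \<open>h b\<close>.\<close>

lemma Wh_basis_independent:
  assumes B: "finite B" "span B = Wh_one" "independent B"
    and h: "\<And>b. b \<in> B \<Longrightarrow> h b \<in> carrier (free_alg cartan)"
    and sum: "(\<Sum>b \<in> B. free_act scale rho (h b) b) = 0"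
    and "b \<in> B"
  shows "h b \<in> cartan_ideal"
proof -
  let ?exp = "\<lambda>c n. \<Sum>i<n. \<Sum>j<n. fa_scale (c i j) (binom_elt i j)"
  obtain c where "\<forall>b \<in> B. eventually (\<lambda>n. h b - ?exp (c b) n \<in> cartan_ideal) sequentially"
    using bchoice[of B "\<lambda>b c. eventually (\<lambda>n. h b - ?exp c n \<in> cartan_ideal) sequentially"]
      carrier_binom_expansion[OF h] by blast
  then have "eventually (\<lambda>n. \<forall>b \<in> B. h b - ?exp (c b) n \<in> cartan_ideal) sequentially"
    by (simp add: eventually_ball_finite_distrib B(1))
  then obtain n where n: "\<And>b. b \<in> B \<Longrightarrow> h b - ?exp (c b) n \<in> cartan_ideal"
    by (auto simp: eventually_sequentially)
  let ?C = "\<lambda>i j v. s1.binom i (s2.binom j v)"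
  let ?y = "\<lambda>i j. \<Sum>b \<in> B. scale (c b i j) b"
  interpret b1: Vector_Spaces.linear scale scale "s1.binom m" for m
    by (rule linear_choose_op) unfold_locales
  interpret b2: Vector_Spaces.linear scale scale "s2.binom m" for m
    by (rule linear_choose_op) unfold_locales
  have act: "free_act scale rho (h b) b = (\<Sum>i<n. \<Sum>j<n. scale (c b i j) (?C i j b))" if "b \<in> B" for b
    using free_act_cartan_ideal[OF n[OF that], of b]
    by (simp add: free_act_diff free_act_sum free_act_fa_scale free_act_binom_elt)
  have "(\<Sum>i<n. \<Sum>j<n. ?C i j (?y i j)) = (\<Sum>i<n. \<Sum>j<n. \<Sum>b \<in> B. scale (c b i j) (?C i j b))"
    by (simp add: b1.sum b2.sum b1.scale b2.scale)
  also have "\<dots> = (\<Sum>i<n. \<Sum>b \<in> B. \<Sum>j<n. scale (c b i j) (?C i j b))"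
    by (intro sum.cong refl sum.swap)
  also have "\<dots> = (\<Sum>b \<in> B. \<Sum>i<n. \<Sum>j<n. scale (c b i j) (?C i j b))"
    by (rule sum.swap)
  also have "\<dots> = 0"
    using sum act by simp
  finally have "(\<Sum>i<n. \<Sum>j<n. ?C i j (?y i j)) = 0" .
  moreover have "?y i j \<in> Wh_one" for i j
    unfolding B(2)[symmetric] by (intro span_sum span_scale span_base)
  ultimately have "?y i j = 0" if "i < n" "j < n" for i j
    using Wh_one_binom_independent[of ?y] that by blast
  then have "c b i j = 0" if "i < n" "j < n" for i j
    using independentD[OF B(3,1) order_refl, of "\<lambda>b. c b i j"] that \<open>b \<in> B\<close> by blast
  then show ?thesis using n[OF \<open>b \<in> B\<close>] by simp
qed

lemma free_over_U_cartan: "free_finite_rank_over_U_cartan scale rho"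
proof -
  let ?coset = "\<lambda>f. cartan_ideal +>\<^bsub>free_alg cartan\<^esub> f"
  have carrier_U: "carrier U_cartan = ?coset ` carrier (free_alg cartan)"
    by (auto simp: env_alg_def FactRing_def A_RCOSETS_def' cartan_ideal_def)
  have act: "env_act scale rho (?coset f) v = free_act scale rho f v"
    if "f \<in> carrier (free_alg cartan)" for f v
    using env_act_coset_cartan[OF that] by (simp add: cartan_ideal_def)
  obtain B0 where B0: "finite B0" "span B0 = Wh_one" using finite_dim_Wh by blast
  obtain B where B: "B \<subseteq> B0" "independent B" "B0 \<subseteq> span B"
    using maximal_independent_subset[of B0] by blast
  have fin: "finite B" using B(1) B0(1) by (rule finite_subset)
  have sp: "span B = Wh_one"
    using B B0(2) by (metis span_mono span_span subset_antisym span_minimal subspace_span)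
  show ?thesis
    unfolding free_finite_rank_over_U_cartan_def
  proof (intro exI[of _ B] conjI allI fin ex_ex1I)
    fix v
    obtain f where f: "\<forall>b \<in> B. f b \<in> carrier (free_alg cartan)"
        "v = (\<Sum>b \<in> B. free_act scale rho (f b) b)"
      using Wh_basis_spans[OF fin sp] by blast
    show "\<exists>u. u \<in> B \<rightarrow>\<^sub>E carrier U_cartan \<and> v = (\<Sum>b \<in> B. env_act scale rho (u b) b)"
      using f by (intro exI[of _ "restrict (\<lambda>b. ?coset (f b)) B"]) (auto simp: carrier_U act)
  next
    fix v u u'
    assume u: "u \<in> B \<rightarrow>\<^sub>E carrier U_cartan \<and> v = (\<Sum>b \<in> B. env_act scale rho (u b) b)"
      and u': "u' \<in> B \<rightarrow>\<^sub>E carrier U_cartan \<and> v = (\<Sum>b \<in> B. env_act scale rho (u' b) b)"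
    have rep: "\<exists>f. \<forall>b \<in> B. f b \<in> carrier (free_alg cartan) \<and> u b = ?coset (f b)"
      if "u \<in> B \<rightarrow>\<^sub>E carrier U_cartan" for u
      using that by (intro bchoice) (auto simp: carrier_U)
    obtain f where "\<forall>b \<in> B. f b \<in> carrier (free_alg cartan) \<and> u b = ?coset (f b)"
      using rep[OF conjunct1[OF u]] ..
    then have f: "f b \<in> carrier (free_alg cartan)" "u b = ?coset (f b)" if "b \<in> B" for b
      using that by simp_all
    obtain g where "\<forall>b \<in> B. g b \<in> carrier (free_alg cartan) \<and> u' b = ?coset (g b)"
      using rep[OF conjunct1[OF u']] ..
    then have g: "g b \<in> carrier (free_alg cartan)" "u' b = ?coset (g b)" if "b \<in> B" for b
      using that by simp_all
    have "(\<Sum>b \<in> B. free_act scale rho (f b) b) = (\<Sum>b \<in> B. free_act scale rho (g b) b)"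
      using u u' by (simp add: f g act)
    then have "(\<Sum>b \<in> B. free_act scale rho (f b - g b) b) = 0"
      by (simp add: free_act_diff sum_subtractf)
    then have I: "f b - g b \<in> cartan_ideal" if "b \<in> B" for b
      using Wh_basis_independent[OF fin sp B(2), of "\<lambda>b. f b - g b" b] that
      by (simp add: free_alg_diff f g)
    show "u = u'"
    proof (rule PiE_ext[of u B "\<lambda>_. carrier U_cartan"])
      show "u b = u' b" if "b \<in> B" for b
        using cartan_coset_eq[OF f(1) g(1) I] that by (simp add: f(2) g(2))
    qed (use u u' in auto)
  qed
qed

end

theorem corollary4p4:
  fixes scale :: "complex \<Rightarrow> 'm::ab_group_add \<Rightarrow> 'm"
    and rho :: "vfield \<Rightarrow> 'm \<Rightarrow> 'm"
  assumes "Omega_one scale rho"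
    and "\<exists>v::'m. v \<noteq> 0"
  shows "free_finite_rank_over_U_cartan scale rho"
  using assms(1) by (rule Omega_one.free_over_U_cartan)

end
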